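(* Let $\boldsymbol{E}, \boldsymbol{A} \in \mathbb{C}^{n \times n}$ with $\boldsymbol{E}$ nonsingular, let $\boldsymbol{b} \in \mathbb{C}^{n}$, and let $\boldsymbol{Q} \in \mathbb{R}^{n \times n}$ be Hermitian. Let $\boldsymbol{V}, \boldsymbol{W} \in \mathbb{C}^{n \times r}$ be basis matrices of $r$-dimensional subspaces of $\mathbb{C}^n$, and define the projected matrices $$\widehat{\boldsymbol{E}} = \boldsymbol{W}^{\mathsf{H}} \boldsymbol{E} \boldsymbol{V}, \quad \widehat{\boldsymbol{A}} = \boldsymbol{W}^{\mathsf{H}} \boldsymbol{A} \boldsymbol{V}, \quad \widehat{\boldsymbol{b}} = \boldsymbol{W}^{\mathsf{H}} \boldsymbol{b}, \quad \widehat{\boldsymbol{Q}} = \boldsymbol{V}^{\mathsf{H}} \boldsymbol{Q} \boldsymbol{V}.$$ Let $H$ and $\widehat{H}$ be the complex-valued functions $$H(z) = \boldsymbol{b}^{\mathsf{H}} (z\boldsymbol{E} - \boldsymbol{A})^{-\mathsf{H}} \boldsymbol{Q} (z\boldsymbol{E} - \boldsymbol{A})^{-1} \boldsymbol{b}, \qquad \widehat{H}(z) = \widehat{\boldsymbol{b}}^{\mathsf{H}} (z\widehat{\boldsymbol{E}} - \widehat{\boldsymbol{A}})^{-\mathsf{H}} \widehat{\boldsymbol{Q}} (z\widehat{\boldsymbol{E}} - \widehat{\boldsymbol{A}})^{-1} \widehat{\boldsymbol{b}},$$ both restricted to the imaginary axis, $z \in \mathfrak{i}\mathbb{R}$. Let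 $z_1, \ldots, z_k \in \mathfrak{i}\mathbb{R}$ be interpolation points in which $H$ and $\widehat{H}$ can be evaluated, and suppose that $$(z_i \boldsymbol{E} - \boldsymbol{A})^{-1} \boldsymbol{b} \in \operatorname{span}(\boldsymbol{V}) \quad\text{and}\quad (z_i \boldsymbol{E} - \boldsymbol{A})^{-\mathsf{H}} \boldsymbol{Q} (z_i \boldsymbol{E} - \boldsymbol{A})^{-1} \boldsymbol{b} \in \operatorname{span}(\boldsymbol{W})$$ for $i = 1, \ldots, k$. Then, for $i = 1, \ldots, k$, $$H(z_i) = \widehat{H}(z_i) \quad\text{and}\quad \frac{\mathrm{d}}{\mathrm{d} z} H(z_i) = \frac{\mathrm{d}}{\mathrm{d} z} \widehat{H}(z_i).$$
   Context: Here $\mathfrak{i}$ is the imaginary unit, $\boldsymbol{M}^{\mathsf{H}}$ denotes the conjugate transpose of a matrix or vector $\boldsymbol{M}$, and $\boldsymbol{M}^{-\mathsf{H}} = (\boldsymbol{M}^{-1})^{\mathsf{H}}$. For a matrix $\boldsymbol{V}$, $\operatorname{span}(\boldsymbol{V})$ is the column space of $\boldsymbol{V}$; a basis matrix of an $r$-dimensional subspace is an $n \times r$ matrix whose columns form a basis of that subspace. The reduced dimension $r$ is thought of as much smaller than $n$, with no quantitative requirement. The function $H$ is the transfer function of the frequency-domain linear quadratic-output system $(s\boldsymbol{E} - \boldsymbol{A})\boldsymbol{x}(s) = \boldsymbol{b}\,u(s)$, $y(s)^2 = \boldsymbol{x}(s)^{\mathsf{H}} \boldsymbol{Q} \boldsymbol{x}(s)$,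 and $\widehat{H}$ is the transfer function of the reduced-order system with matrices $\widehat{\boldsymbol{E}}, \widehat{\boldsymbol{A}}, \widehat{\boldsymbol{b}}, \widehat{\boldsymbol{Q}}$. That $H$ and $\widehat{H}$ can be evaluated in $z_i$ means that the matrices $z_i \boldsymbol{E} - \boldsymbol{A}$ and $z_i \widehat{\boldsymbol{E}} - \widehat{\boldsymbol{A}}$ are both invertible. The functions $H$ and $\widehat{H}$ are in general not complex analytic, since they depend on $\overline{z}$. The derivative $\frac{\mathrm{d}}{\mathrm{d}z}$ is understood along the imaginary axis, i.e., $\frac{\mathrm{d}}{\mathrm{d}z}H(z_i) = \lim (H(z) - H(z_i))/(z - z_i)$ as $z \to z_i$ with $z \in \mathfrak{i}\mathbb{R}$, $z \neq z_i$. Equivalently, for $z \in \mathfrak{i}\mathbb{R}$ one has $\overline{z} = -z$, so $H(z) = \boldsymbol{b}^{\mathsf{H}} (-z\boldsymbol{E}^{\mathsf{H}} - \boldsymbol{A}^{\mathsf{H}})^{-1} \boldsymbol{Q} (z\boldsymbol{E} - \boldsymbol{A})^{-1} \boldsymbol{b}$, and this expression is differentiated in $z$; likewise for $\widehat{H}$. *)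

theory Defs
  imports "HOL-Analysis.Analysis"
begin

definition conj_transpose :: "complex^'n^'m \<Rightarrow> complex^'m^'n" where
  "conj_transpose M = (\<chi> i j. cnj (M $ j $ i))"

definition hermitian :: "complex^'n^'n \<Rightarrow> bool" where
  "hermitian M \<longleftrightarrow> conj_transpose M = M"

text \<open>The pencil $z E - A$. The library operators for scaling a matrix as a whole do not cover complex
  scalars, hence the entrywise multiplication by \<open>z\<close>.\<close>

definition pencil :: "complex^'n^'n \<Rightarrow> complex^'n^'n \<Rightarrow> complex \<Rightarrow> complex^'n^'n" where
  "pencil E A z = map_matrix ((*) z) E - A"

text \<open>The value $b^H (zE - A)^{-H} Q (zE - A)^{-1} b$. It is meaningful only where the pencil
  is invertible, since \<^const>\<open>matrix_inv\<close> of a singular matrix is unspecified. The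
  row vector $b^H$ is the entrywise conjugate of \<open>b\<close>; \<^const>\<open>scalar_product\<close> is bilinear and does
  not conjugate.\<close>

definition transfer_function ::
  "complex^'n^'n \<Rightarrow> complex^'n^'n \<Rightarrow> complex^'n \<Rightarrow> complex^'n^'n \<Rightarrow> complex \<Rightarrow> complex" where
  "transfer_function E A b Q z =
     scalar_product (\<chi> i. cnj (b $ i))
       (conj_transpose (matrix_inv (pencil E A z)) *v (Q *v (matrix_inv (pencil E A z) *v b)))"

text \<open>\<^const>\<open>columns\<close> is a set, so \<^const>\<open>inj\<close> is what excludes repeated columns. Linear
  independence, span and dimension are over the complex numbers (prefix \<open>vec\<close>), not over the reals.\<close>

definition basis_matrix :: "complex^'r^'n \<Rightarrow> (complex^'n) set \<Rightarrow> bool" where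
  "basis_matrix V S \<longleftrightarrow>
     inj (\<lambda>j. column j V) \<and> vec.independent (columns V) \<and> vec.span (columns V) = S"

definition imaginary_axis :: "complex set" where
  "imaginary_axis = {z. Re z = 0}"

end

theory Submission
  imports Defs
begin

text \<open>With the state \<open>x(z) = (zE - A)\<^sup>-\<^sup>1 b\<close>, the transfer function is the sesquilinear expression
  \<open>H(z) = \<langle>x(z), Q x(z)\<rangle>\<close>. The resolvent identity \<open>x(z) - x(w) = (w - z) (zE - A)\<^sup>-\<^sup>1 E x(w)\<close>
  lets the factor \<open>z - w\<close> be split off from \<open>H(z) - H(w)\<close>: it comes out directly from the second
  argument of the form and conjugated from the first one, and on the imaginary axis conjugation
  only changes its sign. The remaining factor is continuous at \<open>w\<close>, and its limit is
  \<open>\<langle>E x, y\<rangle> - \<langle>y, E x\<rangle>\<close>, where \<open>x = x(w)\<close> and \<open>y = (wE - A)\<^sup>-\<^sup>H Q x\<close> is the adjoint state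
  (\<open>transfer_function_has_derivative\<close>). So the state and the adjoint state at \<open>w\<close>
  determine both the value and the derivative there.

  The two span hypotheses say that projection loses neither of them: if \<open>x\<close> lies in the span of
  \<open>V\<close> and \<open>y\<close> in that of \<open>W\<close>, their coefficient vectors solve the reduced equations
  (\<open>projected_state\<close>, \<open>projected_adjoint_state\<close>), hence are the reduced state and adjoint state.
  Substituting \<open>x = V \<xi>\<close> and \<open>y = W \<eta>\<close> into \<open>\<langle>x, Q x\<rangle>\<close> and \<open>\<langle>y, E x\<rangle>\<close> then gives
  the same expressions for the reduced matrices.\<close>

section \<open>The Hermitian form and conjugate transposes\<close>

text \<open>The standard Hermitian form on complex vectors. The library inner product on this type is its
  real part; the derivative below is the purely imaginary number \<open>\<langle>E x, y\<rangle> - \<langle>y, E x\<rangle>\<close>, which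
  the real part would not see.\<close>

definition hermitian_form :: "complex^'n \<Rightarrow> complex^'n \<Rightarrow> complex" where
  "hermitian_form u v = scalar_product (\<chi> i. cnj (u $ i)) v"

lemma hermitian_form_sum: "hermitian_form u v = (\<Sum>i\<in>UNIV. cnj (u $ i) * v $ i)"
  by (simp add: hermitian_form_def scalar_product_def)

lemma hermitian_form_diff_left:
  "hermitian_form (u - u') v = hermitian_form u v - hermitian_form u' v"
  by (simp add: hermitian_form_sum algebra_simps sum_subtractf)

lemma hermitian_form_diff_right:
  "hermitian_form u (v - v') = hermitian_form u v - hermitian_form u v'"
  by (simp add: hermitian_form_sum algebra_simps sum_subtractf)

lemma hermitian_form_scale_left: "hermitian_form (c *s u) v = cnj c * hermitian_form u v"
  by (simp add: hermitian_form_sum sum_distrib_left mult.assoc)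

lemma hermitian_form_scale_right: "hermitian_form u (c *s v) = c * hermitian_form u v"
  by (simp add: hermitian_form_sum sum_distrib_left mult.left_commute)

lemma tendsto_hermitian_form [tendsto_intros]:
  assumes "(f \<longlongrightarrow> u) F" and "(g \<longlongrightarrow> v) F"
  shows "((\<lambda>z. hermitian_form (f z) (g z)) \<longlongrightarrow> hermitian_form u v) F"
  unfolding hermitian_form_sum by (intro tendsto_intros assms)

lemma conj_transpose_conj_transpose [simp]: "conj_transpose (conj_transpose M) = M"
  by (simp add: conj_transpose_def vec_eq_iff)

lemma conj_transpose_mult:
  "conj_transpose (M ** N) = conj_transpose N ** conj_transpose M"
  by (simp add: conj_transpose_def matrix_matrix_mult_def vec_eq_iff mult.commute)

lemma conj_transpose_mat_1 [simp]: "conj_transpose (mat 1) = mat 1"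
  by (simp add: conj_transpose_def mat_def vec_eq_iff)

lemma hermitian_form_adjoint:
  "hermitian_form (M *v u) v = hermitian_form u (conj_transpose M *v v)"
proof -
  have "hermitian_form (M *v u) v = (\<Sum>i\<in>UNIV. \<Sum>j\<in>UNIV. cnj (M $ i $ j) * cnj (u $ j) * v $ i)"
    by (simp add: hermitian_form_sum matrix_vector_mult_def sum_distrib_right)
  also have "\<dots> = (\<Sum>j\<in>UNIV. \<Sum>i\<in>UNIV. cnj (M $ i $ j) * cnj (u $ j) * v $ i)"
    by (rule sum.swap)
  also have "\<dots> = hermitian_form u (conj_transpose M *v v)"
    by (simp add: hermitian_form_sum matrix_vector_mult_def conj_transpose_def sum_distrib_left
        mult.commute mult.left_commute)
  finally show ?thesis .
qed

lemma hermitian_form_adjoint':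
  "hermitian_form u (M *v v) = hermitian_form (conj_transpose M *v u) v"
  by (simp add: hermitian_form_adjoint)

section \<open>Inverses of the pencil\<close>

lemma matrix_inv_inverse:
  fixes M :: "complex^'n^'n"
  assumes "invertible M"
  shows "M ** matrix_inv M = mat 1" and "matrix_inv M ** M = mat 1"
  using someI_ex[OF assms[unfolded invertible_def]] by (simp_all add: matrix_inv_def)

lemma
  fixes M :: "complex^'n^'n"
  assumes "invertible M"
  shows matrix_inv_mult_vec: "matrix_inv M *v (M *v v) = v"
    and mult_matrix_inv_vec: "M *v (matrix_inv M *v v) = v"
  by (simp_all add: matrix_vector_mul_assoc matrix_inv_inverse[OF assms])

lemma conj_transpose_matrix_inv_mult_vec:
  fixes M :: "complex^'n^'n"
  assumes "invertible M"
  shows "conj_transpose (matrix_inv M) *v (conj_transpose M *v v) = v"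
    and "conj_transpose M *v (conj_transpose (matrix_inv M) *v v) = v"
  by (simp_all add: matrix_vector_mul_assoc matrix_inv_inverse[OF assms] flip: conj_transpose_mult)

lemma pencil_mult_vec: "pencil E A z *v u = z *s (E *v u) - A *v u"
  by (simp add: pencil_def matrix_vector_mult_def vec_eq_iff algebra_simps sum_subtractf
      sum_distrib_left)

lemma pencil_projection:
  "pencil (P ** E ** V) (P ** A ** V) z *v u = P *v (pencil E A z *v (V *v u))"
  by (simp add: pencil_mult_vec matrix_vector_mul_assoc[symmetric] matrix_vector_mult_diff_distrib
      vec.scale)

lemma resolvent_identity:
  assumes "invertible (pencil E A z)" and "invertible (pencil E A w)"
  shows "matrix_inv (pencil E A z) *v b - matrix_inv (pencil E A w) *v b =
    (w - z) *s (matrix_inv (pencil E A z) *v (E *v (matrix_inv (pencil E A w) *v b)))"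
proof -
  let ?x = "matrix_inv (pencil E A w) *v b"
  have "(w - z) *s (E *v ?x) = pencil E A w *v ?x - pencil E A z *v ?x"
    by (simp add: pencil_mult_vec vec.scale_left_diff_distrib)
  also have "\<dots> = b - pencil E A z *v ?x"
    by (simp add: mult_matrix_inv_vec[OF assms(2)])
  finally have "matrix_inv (pencil E A z) *v ((w - z) *s (E *v ?x)) =
      matrix_inv (pencil E A z) *v b - ?x"
    by (simp add: matrix_vector_mult_diff_distrib matrix_inv_mult_vec[OF assms(1)])
  then show ?thesis
    by (simp add: vec.scale matrix_vector_mult_diff_distrib)
qed

lemma tendsto_det:
  fixes f :: "'a \<Rightarrow> complex^'n^'n"
  assumes "\<And>i j. ((\<lambda>z. f z $ i $ j) \<longlongrightarrow> M $ i $ j) F"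
  shows "((\<lambda>z. det (f z)) \<longlongrightarrow> det M) F"
  unfolding det_def by (intro tendsto_intros assms)

lemma tendsto_pencil_entry:
  "((\<lambda>z. pencil E A z $ i $ j) \<longlongrightarrow> pencil E A w $ i $ j) (at w within S)"
  unfolding pencil_def by (simp, intro tendsto_intros)

lemma eventually_invertible_pencil:
  assumes "invertible (pencil E A w)"
  shows "eventually (\<lambda>z. invertible (pencil E A z)) (at w within S)"
proof -
  have "((\<lambda>z. det (pencil E A z)) \<longlongrightarrow> det (pencil E A w)) (at w within S)"
    by (intro tendsto_det tendsto_pencil_entry)
  then show ?thesis
    using assms unfolding invertible_det_nz by (rule tendsto_imp_eventually_ne)
qed

text \<open>Cramer's rule expresses the solution through determinants, which are continuous in the
  matrix entries.\<close>

lemma tendsto_pencil_solution: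
  assumes "invertible (pencil E A w)"
  shows "((\<lambda>z. matrix_inv (pencil E A z) *v v) \<longlongrightarrow> matrix_inv (pencil E A w) *v v)
    (at w within S)"
proof -
  define c where "c z = (\<chi> k. det (\<chi> i j. if j = k then v $ i else pencil E A z $ i $ j)
    / det (pencil E A z))" for z
  have c: "matrix_inv (pencil E A z) *v v = c z" if "invertible (pencil E A z)" for z
    using cramer[of "pencil E A z" "matrix_inv (pencil E A z) *v v" v] that
    by (simp add: c_def invertible_det_nz mult_matrix_inv_vec)
  have "(c \<longlongrightarrow> c w) (at w within S)"
    unfolding c_def
  proof (intro tendsto_vec_lambda tendsto_divide tendsto_det tendsto_pencil_entry)
    show "det (pencil E A w) \<noteq> 0"
      using assms by (simp add: invertible_det_nz)
    show "((\<lambda>z. (\<chi> i j. if j = k then v $ i else pencil E A z $ i $ j) $ i $ j)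
        \<longlongrightarrow> (\<chi> i j. if j = k then v $ i else pencil E A w $ i $ j) $ i $ j) (at w within S)" for i j k
      by (cases "j = k") (simp_all add: tendsto_pencil_entry)
  qed
  moreover have "eventually (\<lambda>z. c z = matrix_inv (pencil E A z) *v v) (at w within S)"
    using eventually_invertible_pencil[OF assms] by eventually_elim (simp add: c)
  ultimately show ?thesis
    by (simp add: c[OF assms] Lim_transform_eventually)
qed

section \<open>The derivative of the transfer function\<close>

lemma transfer_function_hermitian_form:
  "transfer_function E A b Q z =
    hermitian_form (matrix_inv (pencil E A z) *v b) (Q *v (matrix_inv (pencil E A z) *v b))"
  by (simp add: transfer_function_def hermitian_form_adjoint flip: hermitian_form_def)

text \<open>The product rule for \<open>\<langle>x(z), Q x(z)\<rangle>\<close>, with the resolvent identity in place of the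
  derivative of \<open>x\<close>. On the axis the conjugated factor \<open>w - z\<close> is \<open>z - w\<close>, which makes the
  contributions of the two arguments differ in sign and the difference quotient converge. That \<open>Q\<close>
  is Hermitian makes both contributions expressible by the one adjoint state \<open>y\<close>.\<close>

lemma transfer_function_has_derivative:
  fixes E A Q :: "complex^'n^'n" and b :: "complex^'n"
  assumes Q: "hermitian Q"
    and w: "w \<in> imaginary_axis"
    and inv: "invertible (pencil E A w)"
  defines "x \<equiv> matrix_inv (pencil E A w) *v b"
  defines "y \<equiv> conj_transpose (matrix_inv (pencil E A w)) *v (Q *v x)"
  shows "(transfer_function E A b Q has_field_derivative
      hermitian_form (E *v x) y - hermitian_form y (E *v x)) (at w within imaginary_axis)"
proof -
  let ?F = "at w within imaginary_axis"
  let ?H = "transfer_function E A b Q"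
  let ?R = "\<lambda>z. matrix_inv (pencil E A z)"
  define g where "g z = hermitian_form (?R z *v (E *v x)) (Q *v (?R z *v b))
    - hermitian_form (Q *v x) (?R z *v (E *v x))" for z
  have Q_cont: "((\<lambda>z. Q *v f z) \<longlongrightarrow> Q *v l) ?F" if "(f \<longlongrightarrow> l) ?F" for f l
    using that by (rule bounded_linear.tendsto[OF matrix_vector_mul_bounded_linear])
  have "(g \<longlongrightarrow> g w) ?F"
    unfolding g_def by (intro tendsto_intros Q_cont tendsto_pencil_solution inv)
  also have "g w = hermitian_form (E *v x) y - hermitian_form y (E *v x)"
    by (simp add: g_def y_def hermitian_form_adjoint[of "?R w" "E *v x"]
        hermitian_form_adjoint'[of _ "?R w" "E *v x"] flip: x_def)
  finally have lim: "(g \<longlongrightarrow> hermitian_form (E *v x) y - hermitian_form y (E *v x)) ?F" .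
  have quotient: "g z = (?H z - ?H w) / (z - w)"
    if z: "z \<in> imaginary_axis" "z \<noteq> w" and inv_z: "invertible (pencil E A z)" for z
  proof -
    define u where "u = ?R z *v (E *v x)"
    have diff: "?R z *v b - x = (w - z) *s u"
      unfolding x_def u_def by (rule resolvent_identity[OF inv_z inv])
    have cnj_diff: "cnj (w - z) = z - w"
      using z(1) w by (simp add: imaginary_axis_def complex_eq_iff)
    have "?H z - ?H w = hermitian_form (?R z *v b - x) (Q *v (?R z *v b))
        + hermitian_form x (Q *v (?R z *v b - x))"
      by (simp add: transfer_function_hermitian_form hermitian_form_diff_left
          hermitian_form_diff_right matrix_vector_mult_diff_distrib flip: x_def)
    also have "hermitian_form x (Q *v (?R z *v b - x)) = hermitian_form (Q *v x) (?R z *v b - x)"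
      using Q by (simp add: hermitian_form_adjoint hermitian_def)
    also have "hermitian_form (?R z *v b - x) (Q *v (?R z *v b))
        + hermitian_form (Q *v x) (?R z *v b - x) = (z - w) * g z"
      unfolding diff hermitian_form_scale_left hermitian_form_scale_right cnj_diff g_def
      by (simp add: algebra_simps flip: u_def)
    finally show ?thesis
      using z(2) by simp
  qed
  have "eventually (\<lambda>z. z \<in> imaginary_axis \<and> z \<noteq> w) ?F"
    by (simp add: eventually_at_filter)
  with eventually_invertible_pencil[OF inv]
  have "eventually (\<lambda>z. g z = (?H z - ?H w) / (z - w)) ?F"
    by eventually_elim (simp add: quotient)
  with lim have "((\<lambda>z. (?H z - ?H w) / (z - w)) \<longlongrightarrow>
      hermitian_form (E *v x) y - hermitian_form y (E *v x)) ?F"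
    by (rule Lim_transform_eventually)
  then show ?thesis
    by (simp add: has_field_derivative_iff)
qed

section \<open>Projection of the state and the adjoint state\<close>

lemma in_span_columnsE:
  fixes V :: "'a::field^'r^'n"
  assumes "x \<in> vec.span (columns V)"
  obtains c where "x = V *v c"
proof -
  have "columns V \<subseteq> range ((*v) V)"
  proof
    fix u
    assume "u \<in> columns V"
    then obtain j where "u = column j V"
      by (auto simp: columns_def)
    then have "u = V *v axis j 1"
      by (simp add: matrix_vector_mult_def column_def axis_def vec_eq_iff if_distrib[of "(*) _"]
          cong: if_cong)
    then show "u \<in> range ((*v) V)" by blast
  qed
  then have "vec.span (columns V) \<subseteq> range ((*v) V)"
    by (intro vec.span_minimal vec.subspace_image vec.subspace_UNIV)
  then show ?thesis
    using assms that by blast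
qed

text \<open>Multiplying \<open>(zE - A) V \<xi> = b\<close> by \<open>P\<close> from the left turns it into the reduced equation
  for \<open>\<xi>\<close>, which has a single solution.\<close>

lemma projected_state:
  assumes "invertible (pencil E A z)"
    and "invertible (pencil (P ** E ** V) (P ** A ** V) z)"
    and "matrix_inv (pencil E A z) *v b = V *v \<xi>"
  shows "matrix_inv (pencil (P ** E ** V) (P ** A ** V) z) *v (P *v b) = \<xi>"
proof -
  have "P *v b = P *v (pencil E A z *v (V *v \<xi>))"
    by (simp add: mult_matrix_inv_vec[OF assms(1)] flip: assms(3))
  also have "\<dots> = pencil (P ** E ** V) (P ** A ** V) z *v \<xi>"
    by (simp add: pencil_projection)
  finally show ?thesis
    by (simp add: matrix_inv_mult_vec[OF assms(2)])
qed

text \<open>The same argument for the adjoint equation \<open>(zE - A)\<^sup>H W \<eta> = q\<close>: here \<open>W\<close> carries the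
  solution, and multiplication by \<open>V\<^sup>H\<close> gives the reduced equation.\<close>

lemma projected_adjoint_state:
  fixes E A :: "complex^'n^'n" and V W :: "complex^'r^'n"
  defines "Eh \<equiv> conj_transpose W ** E ** V" and "Ah \<equiv> conj_transpose W ** A ** V"
  assumes inv: "invertible (pencil E A z)"
    and inv_h: "invertible (pencil Eh Ah z)"
    and y: "conj_transpose (matrix_inv (pencil E A z)) *v q = W *v \<eta>"
  shows "conj_transpose (matrix_inv (pencil Eh Ah z)) *v (conj_transpose V *v q) = \<eta>"
proof -
  have "pencil Eh Ah z = conj_transpose W ** pencil E A z ** V"
    unfolding matrix_eq Eh_def Ah_def
    by (simp add: pencil_projection matrix_vector_mul_assoc[symmetric])
  then have "conj_transpose (pencil Eh Ah z) *v \<eta>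
      = conj_transpose V *v (conj_transpose (pencil E A z) *v (W *v \<eta>))"
    by (simp add: conj_transpose_mult matrix_vector_mul_assoc matrix_mul_assoc)
  also have "\<dots> = conj_transpose V *v q"
    by (simp add: conj_transpose_matrix_inv_mult_vec[OF inv] flip: y)
  finally show ?thesis
    by (metis conj_transpose_matrix_inv_mult_vec(1)[OF inv_h])
qed

lemma hermitian_projection:
  assumes "hermitian Q"
  shows "hermitian (conj_transpose V ** Q ** V)"
  using assms by (simp add: hermitian_def conj_transpose_mult matrix_mul_assoc)

lemma hermitian_form_projection:
  "hermitian_form u ((conj_transpose W ** M ** V) *v v) = hermitian_form (W *v u) (M *v (V *v v))"
  by (simp add: hermitian_form_adjoint matrix_vector_mul_assoc[symmetric])

lemma hermitian_form_projection_left: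
  "hermitian_form ((conj_transpose W ** M ** V) *v v) u = hermitian_form (M *v (V *v v)) (W *v u)"
  by (simp add: hermitian_form_adjoint' matrix_vector_mul_assoc[symmetric])

section \<open>Interpolation by projection\<close>

theorem theorem1:
  fixes E A :: "complex^'n^'n"
    and b :: "complex^'n"
    and Q :: "real^'n^'n"
    and V W :: "complex^'r^'n"
    and \<V> \<W> :: "(complex^'n) set"
    and Eh Ah Qh :: "complex^'r^'r"
    and bh :: "complex^'r"
    and H Hh :: "complex \<Rightarrow> complex"
    and z :: "nat \<Rightarrow> complex"
    and k :: nat
  assumes "invertible E"
    and "hermitian (map_matrix complex_of_real Q)"
    and "vec.subspace \<V>" and "vec.dim \<V> = CARD('r)" and "basis_matrix V \<V>"
    and "vec.subspace \<W>" and "vec.dim \<W> = CARD('r)" and "basis_matrix W \<W>"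
    and "Eh = conj_transpose W ** E ** V"
    and "Ah = conj_transpose W ** A ** V"
    and "bh = conj_transpose W *v b"
    and "Qh = conj_transpose V ** map_matrix complex_of_real Q ** V"
    and "H = transfer_function E A b (map_matrix complex_of_real Q)"
    and "Hh = transfer_function Eh Ah bh Qh"
    and "\<And>i. i \<in> {1..k} \<Longrightarrow> z i \<in> imaginary_axis"
    and "\<And>i. i \<in> {1..k} \<Longrightarrow> invertible (pencil E A (z i))"
    and "\<And>i. i \<in> {1..k} \<Longrightarrow> invertible (pencil Eh Ah (z i))"
    and "\<And>i. i \<in> {1..k} \<Longrightarrow>
           matrix_inv (pencil E A (z i)) *v b \<in> vec.span (columns V)"
    and "\<And>i. i \<in> {1..k} \<Longrightarrow>
           conj_transpose (matrix_inv (pencil E A (z i))) *v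
             (map_matrix complex_of_real Q *v (matrix_inv (pencil E A (z i)) *v b))
           \<in> vec.span (columns W)"
  shows "\<forall>i\<in>{1..k}. H (z i) = Hh (z i) \<and>
           (\<exists>D. (H has_field_derivative D) (at (z i) within imaginary_axis) \<and>
                (Hh has_field_derivative D) (at (z i) within imaginary_axis))"
proof
  fix i
  assume i: "i \<in> {1..k}"
  let ?Q = "map_matrix complex_of_real Q"
  let ?R = "matrix_inv (pencil E A (z i))" and ?Rh = "matrix_inv (pencil Eh Ah (z i))"
  obtain \<xi> where x: "?R *v b = V *v \<xi>"
    using in_span_columnsE[OF assms(18)[OF i]] .
  obtain \<eta> where y: "conj_transpose ?R *v (?Q *v (?R *v b)) = W *v \<eta>"
    using in_span_columnsE[OF assms(19)[OF i]] .
  have xh: "?Rh *v bh = \<xi>"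
    using projected_state[OF assms(16)[OF i] _ x] assms(17)[OF i] assms(9-11) by simp
  have "Qh *v \<xi> = conj_transpose V *v (?Q *v (?R *v b))"
    by (simp add: assms(12) x matrix_vector_mul_assoc[symmetric])
  then have yh: "conj_transpose ?Rh *v (Qh *v (?Rh *v bh)) = \<eta>"
    using projected_adjoint_state[OF assms(16)[OF i] _ y] assms(17)[OF i] assms(9,10) xh by simp
  have "H (z i) = Hh (z i)"
    by (simp add: assms(12-14) transfer_function_hermitian_form x xh hermitian_form_projection)
  moreover
  define D where "D = hermitian_form (E *v (V *v \<xi>)) (W *v \<eta>)
    - hermitian_form (W *v \<eta>) (E *v (V *v \<xi>))"
  have "(H has_field_derivative D) (at (z i) within imaginary_axis)"
    using transfer_function_has_derivative[OF assms(2,15,16), OF i i, of b]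
    unfolding y unfolding x D_def assms(13) .
  moreover have "(Hh has_field_derivative D) (at (z i) within imaginary_axis)"
  proof -
    have "hermitian Qh"
      unfolding assms(12) by (rule hermitian_projection[OF assms(2)])
    from transfer_function_has_derivative[OF this assms(15,17), OF i i, of bh]
    have "(Hh has_field_derivative hermitian_form (Eh *v \<xi>) \<eta> - hermitian_form \<eta> (Eh *v \<xi>))
        (at (z i) within imaginary_axis)"
      unfolding yh unfolding xh assms(14) .
    then show ?thesis
      by (simp add: D_def assms(9) hermitian_form_projection hermitian_form_projection_left)
  qed
  ultimately show "H (z i) = Hh (z i) \<and>
      (\<exists>D. (H has_field_derivative D) (at (z i) within imaginary_axis) \<and>
           (Hh has_field_derivative D) (at (z i) within imaginary_axis))"
    by blast
qed

end
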